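(* Let $N = \{1, 2, \dots, n\}$ index the $n$ input variables of an input sample $\mathbf{x}$, and for each $S \subseteq N$ let $I(S \mid \mathbf{x})$ be the real-valued interaction encoded on $\mathbf{x}$ by a DNN with randomly initialized parameters. Assume that all these interactions represent noises and follow a Gaussian distribution: $\forall S \subseteq N$, $I(S \mid \mathbf{x}) \sim \mathcal{N}(\mathbf{0}, \sigma^2 \cdot \mathbf{I})$, where $\mathbf{I}$ is the identity matrix (i.e. the family $(I(S \mid \mathbf{x}))_{S \subseteq N}$, viewed as a random vector, has this distribution). Let $$\Psi_{\text{pos}}^{(k)} = \sum_{S \subseteq N : |S| = k} \max(I(S \mid \mathbf{x}), 0), \qquad \Psi_{\text{neg}}^{(k)} = \sum_{S \subseteq N : |S| = k} \min(I(S \mid \mathbf{x}), 0)$$ denote the strength of all positive and the strength of all negative AND-OR interactions of the $k$-th order. Then the means of $\Psi_{\text{pos}}^{(k)}$ and $\Psi_{\text{neg}}^{(k)}$ encoded by an initialized DNN are $$\mathbb{E}\big[\Psi_{\text{pos}}^{(k)}\big] = \binom{n}{k} \cdot \sqrt{\frac{\sigma}{2\pi}}, \qquad \mathbb{E}\big[\Psi_{\text{neg}}^{(k)}\big] = -\binom{n}{k} \cdot \sqrt{\frac{\sigma}{2\pi}}.$$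
   Context: An interaction $I(S \mid \mathbf{x}) \in \mathbb{R}$ is a scalar effect attached to a subset $S \subseteq N$ of the input variables of a sample $\mathbf{x} = [x_1, \dots, x_n]^T$; it measures an AND relationship or an OR relationship between the variables in $S$ encoded by the DNN. The order of an interaction is $|S|$, the number of input variables in $S$. For the purposes of this statement, the interactions of a randomly initialized DNN are modelled simply as real random variables, one for each subset $S$, with the Gaussian distribution given in the claim. $\mathbb{E}$ denotes expectation over these random interactions.
   Formalization: The means are stated with sqrt(σ²/(2π)) in place of the printed sqrt(σ/(2π)), which fails for variance σ² unless σ is 0 or 1 (for k ≤ n): for n = k = 0, σ = 4 the true mean is 4/sqrt(2π). *)

theory Defs
  imports "HOL-Probability.Probability"
begin

text \<open>The law on the reals with mean \<open>m\<close> and \<^emph>\<open>variance\<close> \<open>v\<close>; \<open>normal_density\<close> takes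
  the standard deviation. Zero variance gives the point mass at \<open>m\<close>.\<close>

definition normal_law :: "real \<Rightarrow> real \<Rightarrow> real measure" where
  "normal_law m v =
     (if v = 0 then return borel m
      else density lborel (\<lambda>x. ennreal (normal_density m (sqrt v) x)))"

text \<open>The random vector \<open>(X j)\<close>, \<open>j \<in> J\<close>, has the multivariate normal distribution with mean
  vector \<open>\<mu>\<close> and covariance matrix \<open>\<Sigma>\<close>: every linear combination of its coordinates is normal
  with the mean and variance that \<open>\<mu>\<close> and \<open>\<Sigma>\<close> prescribe. This determines the joint law, and it
  also covers singular \<open>\<Sigma>\<close>.\<close>

definition gaussian_vector ::
  "'w measure \<Rightarrow> 'i set \<Rightarrow> ('i \<Rightarrow> 'w \<Rightarrow> real) \<Rightarrow> ('i \<Rightarrow> real) \<Rightarrow> ('i \<Rightarrow> 'i \<Rightarrow> real) \<Rightarrow> bool"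
where
  "gaussian_vector M J X \<mu> \<Sigma> \<longleftrightarrow>
     finite J \<and>
     (\<forall>j\<in>J. X j \<in> borel_measurable M) \<and>
     (\<forall>a. distr M borel (\<lambda>\<omega>. \<Sum>j\<in>J. a j * X j \<omega>) =
          normal_law (\<Sum>j\<in>J. a j * \<mu> j) (\<Sum>i\<in>J. \<Sum>j\<in>J. a i * \<Sigma> i j * a j))"

definition identity_matrix :: "'i \<Rightarrow> 'i \<Rightarrow> real" where
  "identity_matrix i j = (if i = j then 1 else 0)"

text \<open>\<open>I S \<omega>\<close> is the interaction of the set \<open>S\<close> of input variables on the fixed input sample, for
  the network whose random parameters are given by the outcome \<open>\<omega>\<close>.\<close>

definition Psi_pos :: "nat \<Rightarrow> nat \<Rightarrow> (nat set \<Rightarrow> 'w \<Rightarrow> real) \<Rightarrow> 'w \<Rightarrow> real" where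
  "Psi_pos n k I \<omega> = (\<Sum>S | S \<subseteq> {1..n} \<and> card S = k. max (I S \<omega>) 0)"

definition Psi_neg :: "nat \<Rightarrow> nat \<Rightarrow> (nat set \<Rightarrow> 'w \<Rightarrow> real) \<Rightarrow> 'w \<Rightarrow> real" where
  "Psi_neg n k I \<omega> = (\<Sum>S | S \<subseteq> {1..n} \<and> card S = k. min (I S \<omega>) 0)"

text \<open>If \<open>Y\<close> is normal with mean \<open>0\<close> and variance \<open>\<sigma>\<^sup>2\<close>, then the mean of \<open>max Y 0\<close> is
  \<open>sqrt (\<sigma>\<^sup>2 / (2 * pi))\<close>. The published formula has \<open>sqrt (\<sigma> / (2 * pi))\<close>, which is correct
  only for \<open>\<sigma> = 0\<close> and \<open>\<sigma> = 1\<close>; the theorem is stated with the square on \<open>\<sigma>\<close>.\<close>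

end

theory Submission
  imports Defs
begin

text \<open>Only the one-dimensional marginals matter, since the mean of a sum needs no independence.
  For a centred normal \<open>Y\<close> of variance \<open>v\<close>, both means follow from \<open>max Y 0 = (Y + \<bar>Y\<bar>) / 2\<close> and
  \<open>min Y 0 = (Y - \<bar>Y\<bar>) / 2\<close>, because the first absolute moment of \<open>Y\<close> is
  \<open>sqrt (2 * v / pi) = 2 * sqrt (v / (2 * pi))\<close>. The case \<open>v = 0\<close>, a point mass, is separate.\<close>

text \<open>For positive variance the law has a density with respect to \<open>lborel\<close>, so
  the known moments of \<open>normal_density\<close> become moments of
  \<open>normal_law\<close>.\<close>

lemma has_bochner_integral_normal_law:
  fixes f :: "real \<Rightarrow> real"
  assumes "v > 0" "f \<in> borel_measurable borel"
    and "has_bochner_integral lborel (\<lambda>x. normal_density m (sqrt v) x * f x) r"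
  shows "has_bochner_integral (normal_law m v) f r"
  unfolding normal_law_def using assms by (simp add: has_bochner_integral_density)

text \<open>Serves the degenerate law of variance 0. Under a point mass at \<open>x\<close>,
  \<open>f\<close> is almost everywhere bounded by the constant \<open>norm (f x)\<close>, hence
  integrable because the measure is finite.\<close>

lemma has_bochner_integral_return:
  fixes f :: "'a \<Rightarrow> real"
  assumes "x \<in> space N" "f \<in> borel_measurable N"
  shows "has_bochner_integral (return N x) f (f x)"
proof -
  interpret R: prob_space "return N x"
    using assms(1) by (rule prob_space_return)
  have "AE y in return N x. norm (f y) \<le> norm (f x)"
    using assms by (subst AE_return) auto
  then have "integrable (return N x) f"
    using assms(2) by (intro R.integrable_const_bound) auto
  with assms show ?thesis
    by (simp add: has_bochner_integral_iff integral_return)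
qed

lemma normal_law_mean_zero:
  assumes "v \<ge> 0"
  shows "has_bochner_integral (normal_law 0 v) (\<lambda>x. x) 0"
proof (cases "v = 0")
  case True
  then show ?thesis
    using has_bochner_integral_return[of 0 borel "\<lambda>x. x"] by (simp add: normal_law_def)
next
  case False
  then have "v > 0"
    using assms by simp
  then show ?thesis
    using normal_moment_nz_1[of "sqrt v" 0]
    by (intro has_bochner_integral_normal_law) simp_all
qed

lemma normal_law_mean_abs:
  assumes "v \<ge> 0"
  shows "has_bochner_integral (normal_law 0 v) (\<lambda>x. \<bar>x\<bar>) (2 * sqrt (v / (2 * pi)))"
proof (cases "v = 0")
  case True
  then show ?thesis
    using has_bochner_integral_return[of 0 borel abs] by (simp add: normal_law_def)
next
  case False
  then have v: "v > 0"
    using assms by simp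
  \<comment> \<open>\<open>normal_moment_abs_odd\<close> at exponent \<open>2 * 0 + 1\<close> yields
    the value \<open>sqrt v * sqrt (2 / pi)\<close>. Moving the factor 2 under the root matches it
    with the form used here.\<close>
  have "2 * sqrt (v / (2 * pi)) = sqrt (2\<^sup>2 * (v / (2 * pi)))"
    unfolding real_sqrt_mult by simp
  also have "2\<^sup>2 * (v / (2 * pi)) = v * (2 / pi)"
    by (simp add: power2_eq_square)
  finally have "sqrt v * sqrt (2 / pi) = 2 * sqrt (v / (2 * pi))"
    by (simp only: real_sqrt_mult)
  with v show ?thesis
    using normal_moment_abs_odd[of "sqrt v" 0 0]
    by (intro has_bochner_integral_normal_law) simp_all
qed

lemma has_bochner_integral_max_zero:
  fixes X :: "'a \<Rightarrow> real"
  assumes "has_bochner_integral M X a" "has_bochner_integral M (\<lambda>\<omega>. \<bar>X \<omega>\<bar>) b"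
  shows "has_bochner_integral M (\<lambda>\<omega>. max (X \<omega>) 0) ((a + b) / 2)"
proof -
  have "(\<lambda>\<omega>. max (X \<omega>) 0) = (\<lambda>\<omega>. (X \<omega> + \<bar>X \<omega>\<bar>) / 2)"
    by auto
  then show ?thesis
    using has_bochner_integral_divide_zero[OF has_bochner_integral_add[OF assms], of 2] by simp
qed

lemma has_bochner_integral_min_zero:
  fixes X :: "'a \<Rightarrow> real"
  assumes "has_bochner_integral M X a" "has_bochner_integral M (\<lambda>\<omega>. \<bar>X \<omega>\<bar>) b"
  shows "has_bochner_integral M (\<lambda>\<omega>. min (X \<omega>) 0) ((a - b) / 2)"
proof -
  have "(\<lambda>\<omega>. min (X \<omega>) 0) = (\<lambda>\<omega>. (X \<omega> - \<bar>X \<omega>\<bar>) / 2)"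
    by auto
  then show ?thesis
    using has_bochner_integral_divide_zero[OF has_bochner_integral_diff[OF assms], of 2] by simp
qed

text \<open>The coordinate \<open>X j\<close> is itself a linear combination, with the
  \<open>j\<close>-th unit vector \<open>e\<close> as its coefficients; the prescribed mean and
  variance then collapse to single entries.\<close>

lemma gaussian_vector_marginal:
  fixes X :: "'i \<Rightarrow> 'w \<Rightarrow> real"
  assumes "gaussian_vector M J X \<mu> \<Sigma>" "j \<in> J"
  shows "distr M borel (X j) = normal_law (\<mu> j) (\<Sigma> j j)"
proof -
  define e :: "'i \<Rightarrow> real" where "e i = (if i = j then 1 else 0)" for i
  have J: "finite J"
    and G: "distr M borel (\<lambda>\<omega>. \<Sum>i\<in>J. e i * X i \<omega>) =
      normal_law (\<Sum>i\<in>J. e i * \<mu> i) (\<Sum>i\<in>J. \<Sum>l\<in>J. e i * \<Sigma> i l * e l)"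
    using assms(1) unfolding gaussian_vector_def by blast+
  have pick: "(\<Sum>i\<in>J. e i * f i) = f j" for f :: "'i \<Rightarrow> real"
  proof -
    have "(\<Sum>i\<in>J. e i * f i) = (\<Sum>i\<in>J. if i = j then f i else 0)"
      by (intro sum.cong) (simp_all add: e_def)
    with J assms(2) show ?thesis
      by simp
  qed
  \<comment> \<open>With the quadratic form nested this way, \<open>pick\<close> applies once to
    each sum and leaves \<open>\<Sigma> j j\<close>.\<close>
  have "(\<Sum>i\<in>J. \<Sum>l\<in>J. e i * \<Sigma> i l * e l) = (\<Sum>i\<in>J. e i * (\<Sum>l\<in>J. e l * \<Sigma> i l))"
    by (simp add: sum_distrib_left mult_ac)
  then show ?thesis
    using G by (simp only: pick)
qed

text \<open>Change of variables along \<open>X\<close>: it carries the moments computed for the law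
  back to the probability space \<open>M\<close>.\<close>

lemma has_bochner_integral_of_law:
  fixes f :: "'b \<Rightarrow> real"
  assumes "X \<in> measurable M N" "distr M N X = L" "f \<in> borel_measurable N"
    and "has_bochner_integral L f r"
  shows "has_bochner_integral M (\<lambda>\<omega>. f (X \<omega>)) r"
  using assms(2,4) integrable_distr_eq[OF assms(1,3)] integral_distr[OF assms(1,3)]
  by (simp add: has_bochner_integral_iff)

theorem theorem3:
  fixes M :: "'w measure" and I :: "nat set \<Rightarrow> 'w \<Rightarrow> real"
    and n k :: nat and \<sigma> :: real
  assumes "prob_space M"
    and "\<sigma> \<ge> 0"
    and "gaussian_vector M (Pow {1..n}) I (\<lambda>S. 0) (\<lambda>S T. \<sigma>\<^sup>2 * identity_matrix S T)"
  shows "(\<integral>\<omega>. Psi_pos n k I \<omega> \<partial>M) = real (n choose k) * sqrt (\<sigma>\<^sup>2 / (2 * pi))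
    \<and> (\<integral>\<omega>. Psi_neg n k I \<omega> \<partial>M) = - real (n choose k) * sqrt (\<sigma>\<^sup>2 / (2 * pi))"
proof -
  define K where "K = {S. S \<subseteq> {1..n} \<and> card S = k}"
  \<comment> \<open>Half the first absolute moment of a centred normal variable with variance
    \<open>\<sigma>\<^sup>2\<close>, hence the mean of its positive part.\<close>
  define c where "c = sqrt (\<sigma>\<^sup>2 / (2 * pi))"
  have card_K: "card K = n choose k"
    using n_subsets[of "{1..n}" k] by (simp add: K_def)
  have pos: "has_bochner_integral M (\<lambda>\<omega>. max (I S \<omega>) 0) c"
    and neg: "has_bochner_integral M (\<lambda>\<omega>. min (I S \<omega>) 0) (- c)" if "S \<in> K" for S
  proof -
    from that have S: "S \<in> Pow {1..n}"
      by (auto simp: K_def)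
    then have X: "I S \<in> borel_measurable M"
      using assms(3) by (auto simp: gaussian_vector_def)
    have law: "distr M borel (I S) = normal_law 0 (\<sigma>\<^sup>2)"
      using gaussian_vector_marginal[OF assms(3) S] by (simp add: identity_matrix_def)
    have mean: "has_bochner_integral M (\<lambda>\<omega>. I S \<omega>) 0"
      by (rule has_bochner_integral_of_law[where f = "\<lambda>x. x", OF X law _ normal_law_mean_zero])
        simp_all
    have abs: "has_bochner_integral M (\<lambda>\<omega>. \<bar>I S \<omega>\<bar>) (2 * c)"
      unfolding c_def
      by (rule has_bochner_integral_of_law[where f = abs, OF X law _ normal_law_mean_abs])
        simp_all
    show "has_bochner_integral M (\<lambda>\<omega>. max (I S \<omega>) 0) c"
      using has_bochner_integral_max_zero[OF mean abs] by simp
    show "has_bochner_integral M (\<lambda>\<omega>. min (I S \<omega>) 0) (- c)"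
      using has_bochner_integral_min_zero[OF mean abs] by simp
  qed
  \<comment> \<open>\<open>has_bochner_integral\<close> records integrability of each summand along
    with its mean, so the means add up over the \<open>n choose k\<close> sets in
    \<open>K\<close>.\<close>
  have "has_bochner_integral M (Psi_pos n k I) (\<Sum>S\<in>K. c)"
    unfolding Psi_pos_def[abs_def] K_def[symmetric]
    by (intro has_bochner_integral_sum pos)
  moreover have "has_bochner_integral M (Psi_neg n k I) (\<Sum>S\<in>K. - c)"
    unfolding Psi_neg_def[abs_def] K_def[symmetric]
    by (intro has_bochner_integral_sum neg)
  ultimately show ?thesis
    by (simp add: has_bochner_integral_iff card_K c_def)
qed

end
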